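(* Let $C$ be a bivariate copula with $\beta(C)=\beta$. Then \[ 0\leqslant\mu_\infty(C)\leqslant\begin{cases}\dfrac{3+\beta}{8}, & \text{if } -1\leqslant\beta\leqslant-\frac13,\\[2mm] \dfrac{1-\beta}{4}, & \text{if } -\frac13\leqslant\beta\leqslant0,\\[2mm] \dfrac{3-\beta}{12}, & \text{if } 0\leqslant\beta\leqslant1,\end{cases} \] and the bounds are attained (for each $\beta\in[-1,1]$, both the lower and the upper bound are attained by some copula $C$ with $\beta(C)=\beta$).
   Context: For a bivariate copula $C$, the measure of asymmetry is $\mu_\infty(C)=\max_{u,v\in[0,1]}|C(u,v)-C(v,u)|$. Blomqvist's beta is $\beta(C)=4\,C\left(\frac12,\frac12\right)-1$. *)

theory Defs
  imports "HOL-Analysis.Analysis"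
begin

text \<open>
  A copula is represented by a total function \<open>real \<Rightarrow> real \<Rightarrow> real\<close>, of which only the values on the
  unit square matter.
\<close>

definition copula :: "(real \<Rightarrow> real \<Rightarrow> real) \<Rightarrow> bool" where
  "copula C \<longleftrightarrow>
     (\<forall>u\<in>{0..1}. C u 0 = 0 \<and> C 0 u = 0) \<and>
     (\<forall>u\<in>{0..1}. C u 1 = u \<and> C 1 u = u) \<and>
     (\<forall>u1\<in>{0..1}. \<forall>u2\<in>{0..1}. \<forall>v1\<in>{0..1}. \<forall>v2\<in>{0..1}.
        u1 \<le> u2 \<longrightarrow> v1 \<le> v2 \<longrightarrow> C u2 v2 - C u2 v1 - C u1 v2 + C u1 v1 \<ge> 0)"

definition blomqvist_beta :: "(real \<Rightarrow> real \<Rightarrow> real) \<Rightarrow> real" where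
  "blomqvist_beta C = 4 * C (1/2) (1/2) - 1"

text \<open>For copulas this supremum is a maximum, see \<open>mu_infty_attained\<close> and \<open>mu_infty_upper\<close> below.\<close>

definition mu_infty :: "(real \<Rightarrow> real \<Rightarrow> real) \<Rightarrow> real" where
  "mu_infty C = (SUP (u, v)\<in>{0..1} \<times> {0..1}. \<bar>C u v - C v u\<bar>)"

text \<open>Neighbouring formulas agree at \<open>b = -1/3\<close> and at \<open>b = 0\<close>; only \<open>b \<in> {-1..1}\<close> is relevant.\<close>

definition mu_infty_bound :: "real \<Rightarrow> real" where
  "mu_infty_bound b =
     (if b \<le> -1/3 then (3 + b) / 8
      else if b \<le> 0 then (1 - b) / 4
      else (3 - b) / 12)"

lemma copula_lipschitz:
  assumes "copula C" "u \<in> {0..1}" "u' \<in> {0..1}" "v \<in> {0..1}" "v' \<in> {0..1}"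
  shows "\<bar>C u v - C u' v'\<bar> \<le> \<bar>u - u'\<bar> + \<bar>v - v'\<bar>"
proof -
  have m: "C 0 t = 0" "C t 0 = 0" "C 1 t = t" "C t 1 = t" if "t \<in> {0..1}" for t
    using assms(1) that unfolding copula_def by blast+
  have inc: "C p2 q2 - C p2 q1 - C p1 q2 + C p1 q1 \<ge> 0"
    if "p1 \<in> {0..1}" "p2 \<in> {0..1}" "q1 \<in> {0..1}" "q2 \<in> {0..1}" "p1 \<le> p2" "q1 \<le> q2"
    for p1 p2 q1 q2
    using assms(1) that unfolding copula_def by blast
  have x: "0 \<le> C p2 q - C p1 q \<and> C p2 q - C p1 q \<le> p2 - p1"
    if "p1 \<in> {0..1}" "p2 \<in> {0..1}" "q \<in> {0..1}" "p1 \<le> p2" for p1 p2 q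
    using inc[of p1 p2 0 q] inc[of p1 p2 q 1] m(2)[of p1] m(2)[of p2] m(4)[of p1] m(4)[of p2] that
    by auto
  have y: "0 \<le> C q p2 - C q p1 \<and> C q p2 - C q p1 \<le> p2 - p1"
    if "p1 \<in> {0..1}" "p2 \<in> {0..1}" "q \<in> {0..1}" "p1 \<le> p2" for p1 p2 q
    using inc[of 0 q p1 p2] inc[of q 1 p1 p2] m(1)[of p1] m(1)[of p2] m(3)[of p1] m(3)[of p2] that
    by auto
  have "\<bar>C u v - C u' v\<bar> \<le> \<bar>u - u'\<bar>"
    using x[of u u' v] x[of u' u v] assms by linarith
  moreover have "\<bar>C u' v - C u' v'\<bar> \<le> \<bar>v - v'\<bar>"
    using y[of v v' u'] y[of v' v u'] assms by linarith
  ultimately show ?thesis by linarith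
qed

lemma copula_continuous_on:
  assumes "copula C"
  shows "continuous_on ({0..1} \<times> {0..1}) (\<lambda>(u, v). C u v)"
proof -
  have "2-lipschitz_on ({0..1} \<times> {0..1}) (\<lambda>(u, v). C u v)"
  proof (rule lipschitz_onI; clarsimp simp: dist_real_def)
    fix u v u' v' :: real
    assume "0 \<le> u" "u \<le> 1" "0 \<le> v" "v \<le> 1" "0 \<le> u'" "u' \<le> 1" "0 \<le> v'" "v' \<le> 1"
    then have "\<bar>C u v - C u' v'\<bar> \<le> \<bar>u - u'\<bar> + \<bar>v - v'\<bar>"
      using copula_lipschitz[OF assms] by simp
    also have "\<dots> \<le> 2 * dist (u, v) (u', v')"
      using dist_fst_le[of "(u, v)" "(u', v')"] dist_snd_le[of "(u, v)" "(u', v')"]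
      by (simp add: dist_real_def)
    finally show "\<bar>C u v - C u' v'\<bar> \<le> 2 * dist (u, v) (u', v')" .
  qed
  then show ?thesis by (rule lipschitz_on_continuous_on)
qed

lemma asymmetry_continuous_on:
  assumes "copula C"
  shows "continuous_on ({0..1} \<times> {0..1}) (\<lambda>(u, v). \<bar>C u v - C v u\<bar>)"
proof -
  have swap: "prod.swap ` ({0..1} \<times> {0..1}) = ({0..1} \<times> {0..1} :: (real \<times> real) set)"
    by (rule product_swap)
  have "continuous_on ({0..1} \<times> {0..1}) ((\<lambda>(u, v). C u v) \<circ> prod.swap)"
    by (rule continuous_on_compose[OF continuous_on_swap], subst swap)
       (rule copula_continuous_on[OF assms])
  with copula_continuous_on[OF assms]
  have "continuous_on ({0..1} \<times> {0..1})
          (\<lambda>p. \<bar>(\<lambda>(u, v). C u v) p - ((\<lambda>(u, v). C u v) \<circ> prod.swap) p\<bar>)"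
    by (intro continuous_on_rabs continuous_on_diff)
  then show ?thesis by (simp add: case_prod_unfold)
qed

lemma mu_infty_upper:
  assumes "copula C" "u \<in> {0..1}" "v \<in> {0..1}"
  shows "\<bar>C u v - C v u\<bar> \<le> mu_infty C"
proof -
  have "compact ((\<lambda>(u, v). \<bar>C u v - C v u\<bar>) ` ({0..1} \<times> {0..1}))"
    by (intro compact_continuous_image asymmetry_continuous_on assms compact_Times compact_Icc)
  then have "bdd_above ((\<lambda>(u, v). \<bar>C u v - C v u\<bar>) ` ({0..1} \<times> {0..1}))"
    by (intro bounded_imp_bdd_above compact_imp_bounded)
  from cSUP_upper[OF _ this, of "(u, v)"] show ?thesis
    using assms by (simp add: mu_infty_def)
qed

lemma mu_infty_attained:
  assumes "copula C"
  obtains u v where "u \<in> {0..1}" "v \<in> {0..1}" "mu_infty C = \<bar>C u v - C v u\<bar>"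
proof -
  have "\<exists>p\<in>{0..1} \<times> {0..1}. \<forall>q\<in>{0..1} \<times> {0..1}.
      (\<lambda>(u, v). \<bar>C u v - C v u\<bar>) q \<le> (\<lambda>(u, v). \<bar>C u v - C v u\<bar>) p"
    by (intro continuous_attains_sup asymmetry_continuous_on assms compact_Times compact_Icc) auto
  then obtain u v where uv: "u \<in> {0..1}" "v \<in> {0..1}"
    and max: "\<And>q. q \<in> {0..1} \<times> {0..1} \<Longrightarrow> (case q of (x, y) \<Rightarrow> \<bar>C x y - C y x\<bar>) \<le> \<bar>C u v - C v u\<bar>"
    by auto
  have "mu_infty C \<le> \<bar>C u v - C v u\<bar>"
    unfolding mu_infty_def by (rule cSUP_least) (use max in auto)
  with mu_infty_upper[OF assms uv] uv show ?thesis
    by (intro that[of u v]) auto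
qed

end

theory Submission
  imports Defs
begin

text \<open>
  Put \<open>d = C (1/2) (1/2)\<close> and \<open>D = C a b - C b a\<close> with \<open>a \<le> b\<close>. Monotonicity and the Lipschitz
  property confine \<open>C a b\<close> from above and \<open>C b a\<close> from below in terms of \<open>a\<close>, \<open>b\<close> and \<open>d\<close>, and
  eliminating \<open>a\<close> and \<open>b\<close> from the resulting linear inequalities gives the upper bound; for instance
  \<open>D \<le> a\<close>, \<open>D \<le> b - a\<close> and \<open>D \<le> 1 - d - b\<close> if \<open>b \<le> 1/2\<close>, whence \<open>3 * D \<le> 1 - d\<close>.
  The extremal copulas are the pointwise smallest or largest ones with one prescribed value, at a
  point where these inequalities are tight.
\<close>

lemma copula_transpose: "copula C \<Longrightarrow> copula (\<lambda>u v. C v u)"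
  unfolding copula_def by (smt (verit))

text \<open>A rectangle's volume is the \<open>C\<close>-volume of its reflection under
  \<open>v \<mapsto> 1 - v\<close>. The reflection swaps lower and upper bounds, so it turns
  smallest copulas into largest ones.\<close>

lemma copula_flip:
  assumes "copula C"
  shows "copula (\<lambda>u v. u - C u (1 - v))"
proof -
  have bd: "C t 0 = 0" "C 0 t = 0" "C 1 t = t" "C t 1 = t" if "t \<in> {0..1}" for t
    using assms that unfolding copula_def by blast+
  have inc: "C p2 q2 - C p2 q1 - C p1 q2 + C p1 q1 \<ge> 0"
    if "p1 \<in> {0..1}" "p2 \<in> {0..1}" "q1 \<in> {0..1}" "q2 \<in> {0..1}" "p1 \<le> p2" "q1 \<le> q2"
    for p1 p2 q1 q2
    using assms that unfolding copula_def by blast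
  show ?thesis
    unfolding copula_def
  proof (intro conjI ballI impI)
    fix u1 u2 v1 v2 :: real
    assume "u1 \<in> {0..1}" "u2 \<in> {0..1}" "v1 \<in> {0..1}" "v2 \<in> {0..1}" "u1 \<le> u2" "v1 \<le> v2"
    then show "0 \<le> u2 - C u2 (1 - v2) - (u2 - C u2 (1 - v1)) - (u1 - C u1 (1 - v2))
        + (u1 - C u1 (1 - v1))"
      using inc[of u1 u2 "1 - v2" "1 - v1"] by simp
  qed (simp_all add: bd)
qed

text \<open>For admissible \<open>\<theta>\<close>, the smallest copula with value
  \<open>\<theta>\<close> at \<open>(a, b)\<close>: the Frechet lower bound joined with what
  monotonicity and the Lipschitz property force.\<close>

definition lower_copula :: "real \<Rightarrow> real \<Rightarrow> real \<Rightarrow> real \<Rightarrow> real \<Rightarrow> real" where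
  "lower_copula a b \<theta> u v = max (max 0 (u + v - 1)) (\<theta> - max 0 (a - u) - max 0 (b - v))"

lemma copula_lower_copula:
  assumes "a \<in> {0..1}" "b \<in> {0..1}" "max 0 (a + b - 1) \<le> \<theta>" "\<theta> \<le> min a b"
  shows "copula (lower_copula a b \<theta>)"
proof -
  let ?L = "lower_copula a b \<theta>"
  have "0 \<le> ?L u2 v2 - ?L u2 v1 - ?L u1 v2 + ?L u1 v1"
    if "u1 \<le> u2" "v1 \<le> v2" for u1 u2 v1 v2
    using that assms unfolding lower_copula_def by (smt (verit))
  moreover have "?L u 0 = 0" "?L 0 u = 0" "?L u 1 = u" "?L 1 u = u" if "u \<in> {0..1}" for u
    using that assms unfolding lower_copula_def by auto
  ultimately show ?thesis
    unfolding copula_def by blast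
qed

lemma asymmetry_le_mu_infty_bound:
  assumes C: "copula C" and a: "a \<in> {0..1}" and b: "b \<in> {0..1}" and ab: "a \<le> b"
  shows "C a b - C b a \<le> mu_infty_bound (blomqvist_beta C)"
proof -
  have bd: "C t 0 = 0" "C 0 t = 0" "C 1 t = t" "C t 1 = t" if "t \<in> {0..1}" for t
    using C that unfolding copula_def by blast+
  have inc: "C p2 q2 - C p2 q1 - C p1 q2 + C p1 q1 \<ge> 0"
    if "p1 \<in> {0..1}" "p2 \<in> {0..1}" "q1 \<in> {0..1}" "q2 \<in> {0..1}" "p1 \<le> p2" "q1 \<le> q2"
    for p1 p2 q1 q2
    using C that unfolding copula_def by blast
  have x: "C p1 q \<le> C p2 q \<and> C p2 q - C p1 q \<le> p2 - p1"
    if "p1 \<in> {0..1}" "p2 \<in> {0..1}" "q \<in> {0..1}" "p1 \<le> p2" for p1 p2 q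
    using inc[of p1 p2 0 q] inc[of p1 p2 q 1] bd(1)[of p1] bd(1)[of p2] bd(4)[of p1] bd(4)[of p2] that
    by auto
  have y: "C q p1 \<le> C q p2 \<and> C q p2 - C q p1 \<le> p2 - p1"
    if "p1 \<in> {0..1}" "p2 \<in> {0..1}" "q \<in> {0..1}" "p1 \<le> p2" for p1 p2 q
    using inc[of 0 q p1 p2] inc[of q 1 p1 p2] bd(2)[of p1] bd(2)[of p2] bd(3)[of p1] bd(3)[of p2] that
    by auto
  have h: "(1/2::real) \<in> {0..1}" by simp
  have e: "0 \<le> C p q" "C p q \<le> p" "C p q \<le> q" "p + q - 1 \<le> C p q"
    if "p \<in> {0..1}" "q \<in> {0..1}" for p q
    using x[of 0 p q] x[of p 1 q] y[of 0 q p] y[of q 1 p] bd[of p] bd[of q] that by auto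
  define d where "d = C (1/2) (1/2)"
  define D where "D = C a b - C b a"
  note frechet = e[OF a b] e[OF b a] e[OF h h]
  have D_le: "D \<le> a" "D \<le> b - a" "D \<le> 1 - b" "0 \<le> d" "d \<le> 1/2"
    using frechet y[OF a b a ab] x[OF a b a ab] unfolding D_def d_def by auto
  \<comment> \<open>This is the bound rewritten with \<open>\<beta> = 4 * d - 1\<close>.\<close>
  have "D \<le> (if d \<le> 1/6 then (1 + 2 * d) / 4 else if d \<le> 1/4 then (1 - 2 * d) / 2 else (1 - d) / 3)"
  proof -
    consider "a \<le> 1/2" "1/2 \<le> b" | "b \<le> 1/2" | "1/2 \<le> a" by linarith
    then show ?thesis
    proof cases
      \<comment> \<open>\<open>D \<le> d + b - 1/2\<close> and \<open>D \<le> 1 - b\<close> give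
        \<open>2 * D \<le> d + 1/2\<close>; also \<open>D \<le> 1/2 - d\<close>, which is at most
        \<open>(1 - d) / 3\<close> once \<open>d \<ge> 1/4\<close>.\<close>
      case 1
      then have "C a b \<le> d + b - 1/2" "d + a - 1/2 \<le> C b a"
        using x[OF a h b] y[OF h b h] x[OF h b a] y[OF a h h] unfolding d_def by linarith+
      then show ?thesis
        using frechet D_le unfolding D_def by auto
    next
      case 2
      with ab have "C a b \<le> d" "d + a + b - 1 \<le> C b a"
        using x[OF a h b] y[OF b h h] y[OF a h h] x[OF b h a] unfolding d_def by linarith+
      then show ?thesis
        using frechet D_le unfolding D_def by auto
    next
      \<comment> \<open>Mirror image of the previous case: \<open>D \<le> d\<close>, and
        \<open>3 * D \<le> 1 - d\<close> by adding \<open>D \<le> 1 - b\<close>,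
        \<open>D \<le> b - a\<close> and \<open>D \<le> a - d\<close>.\<close>
      case 3
      with ab have "d \<le> C b a" "C a b \<le> d + a + b - 1"
        using x[OF h b h] y[OF h a b] x[OF h a b] y[OF h b h] unfolding d_def by linarith+
      then show ?thesis
        using frechet D_le unfolding D_def by auto
    qed
  qed
  moreover have "blomqvist_beta C = 4 * d - 1"
    by (simp add: blomqvist_beta_def d_def)
  ultimately show ?thesis
    unfolding D_def mu_infty_bound_def by (auto simp: field_simps split: if_splits)
qed

lemma mu_infty_le_bound:
  assumes "copula C"
  shows "mu_infty C \<le> mu_infty_bound (blomqvist_beta C)"
proof -
  obtain u v where uv: "u \<in> {0..1}" "v \<in> {0..1}" and mu: "mu_infty C = \<bar>C u v - C v u\<bar>"
    using mu_infty_attained[OF assms] .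
  \<comment> \<open>The transpose has the same beta and covers the negative sign.\<close>
  have "\<bar>C a b - C b a\<bar> \<le> mu_infty_bound (blomqvist_beta C)"
    if "a \<in> {0..1}" "b \<in> {0..1}" "a \<le> b" for a b
    using asymmetry_le_mu_infty_bound[OF assms that]
      asymmetry_le_mu_infty_bound[OF copula_transpose[OF assms] that]
    by (simp add: blomqvist_beta_def)
  from this[of u v] this[of v u] show ?thesis
    using uv unfolding mu by linarith
qed

lemma mu_infty_eq_bound:
  assumes "copula C" "a \<in> {0..1}" "b \<in> {0..1}"
    and "C a b - C b a = mu_infty_bound (blomqvist_beta C)"
  shows "mu_infty C = mu_infty_bound (blomqvist_beta C)"
  using mu_infty_le_bound[OF assms(1)] mu_infty_upper[OF assms(1-3)] assms(4) by linarith

lemma mu_infty_bound_attained: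
  assumes "\<beta> \<in> {-1..1}"
  shows "\<exists>C. copula C \<and> blomqvist_beta C = \<beta> \<and> mu_infty C = mu_infty_bound \<beta>"
proof -
  define d where "d = (1 + \<beta>) / 4"
  have \<beta>: "\<beta> = 4 * d - 1" and d: "0 \<le> d" "d \<le> 1/2"
    using assms by (auto simp: d_def field_simps)
  have attained: ?thesis
    if "copula C" "C (1/2) (1/2) = d" "a \<in> {0..1}" "b \<in> {0..1}"
      "C a b - C b a = mu_infty_bound \<beta>" for C a b
    using mu_infty_eq_bound[of C a b] that by (auto simp: blomqvist_beta_def \<beta>)
  consider "d \<le> 1/6" | "1/6 < d" "d \<le> 1/4" | "1/4 < d" by linarith
  then show ?thesis
  proof cases
    case 1
    \<comment> \<open>Solves \<open>2 * a - 1/2 = d\<close>, the value required at the centre. The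
      value at \<open>(1 - a, a)\<close> is \<open>max 0 (3 * a - 1)\<close>, zero because
      \<open>d \<le> 1/6\<close>.\<close>
    define a where "a = (1 + 2 * d) / 4"
    show ?thesis
      by (rule attained[of "lower_copula a (1 - a) a" a "1 - a"], rule copula_lower_copula)
        (use 1 d in \<open>auto simp: a_def lower_copula_def mu_infty_bound_def \<beta> max_def field_simps\<close>)
  next
    case 2
    \<comment> \<open>Makes \<open>D \<le> 1/2 - d\<close> tight; \<open>b = 2 * a\<close> is the
      least \<open>b\<close> with \<open>b - a \<ge> a\<close>, and \<open>3 * a \<le> 1\<close> as
      \<open>d > 1/6\<close>.\<close>
    define a where "a = 1/2 - d"
    show ?thesis
      by (rule attained[of "lower_copula a (2 * a) a" a "2 * a"], rule copula_lower_copula)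
        (use 2 d in \<open>auto simp: a_def lower_copula_def mu_infty_bound_def \<beta> max_def field_simps\<close>)
  next
    case 3
    \<comment> \<open>Equality in \<open>D \<le> a\<close>, \<open>D \<le> b - a\<close> and
      \<open>D \<le> 1 - d - b\<close> forces this \<open>a\<close> and
      \<open>b = 2 * a\<close>.\<close>
    define a where "a = (1 - d) / 3"
    text \<open>On the unit square this is \<open>min u v\<close> capped by \<open>max 0 (u - 2 * a) + max 0 (v - a)\<close>,
      the largest copula that vanishes at \<open>(2 * a, a)\<close>.\<close>
    let ?C = "\<lambda>u v. u - lower_copula (2 * a) (1 - a) (2 * a) u (1 - v)"
    show ?thesis
      by (rule attained[of ?C a "2 * a"], rule copula_flip, rule copula_lower_copula)
        (use 3 d in \<open>auto simp: a_def lower_copula_def mu_infty_bound_def \<beta> max_def field_simps\<close>)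
  qed
qed

lemma symmetric_copula_exists:
  assumes "\<beta> \<in> {-1..1}"
  shows "\<exists>C. copula C \<and> blomqvist_beta C = \<beta> \<and> mu_infty C = 0"
proof -
  let ?C = "lower_copula (1/2) (1/2) ((1 + \<beta>) / 4)"
  have cop: "copula ?C"
    by (rule copula_lower_copula) (use assms in auto)
  have "?C u v = ?C v u" for u v
    by (simp add: lower_copula_def algebra_simps)
  then have "mu_infty ?C = 0"
    using mu_infty_attained[OF cop] by (metis abs_zero diff_self)
  moreover have "blomqvist_beta ?C = \<beta>"
    using assms by (simp add: blomqvist_beta_def lower_copula_def field_simps)
  ultimately show ?thesis
    using cop by blast
qed

theorem corollary21:
  shows "(\<forall>C \<beta>. copula C \<longrightarrow> blomqvist_beta C = \<beta> \<longrightarrow>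
            0 \<le> mu_infty C \<and> mu_infty C \<le> mu_infty_bound \<beta>) \<and>
         (\<forall>\<beta>\<in>{-1..1}.
            (\<exists>C. copula C \<and> blomqvist_beta C = \<beta> \<and> mu_infty C = 0) \<and>
            (\<exists>C. copula C \<and> blomqvist_beta C = \<beta> \<and> mu_infty C = mu_infty_bound \<beta>))"
proof (intro conjI allI ballI impI)
  fix C \<beta>
  assume C: "copula C" and \<beta>: "blomqvist_beta C = \<beta>"
  show "0 \<le> mu_infty C"
    using mu_infty_upper[OF C, of 0 0] by simp
  show "mu_infty C \<le> mu_infty_bound \<beta>"
    using mu_infty_le_bound[OF C] \<beta> by simp
qed (use symmetric_copula_exists mu_infty_bound_attained in auto)

end
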